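(* Let $H$ be a hyperfield, with associated tract $F=F_H$. Then $F$ satisfies the strong fusion axiom (SF) if and only if $H$ is stringent, i.e. $|a\boxplus b|=1$ for all $a,b\in H$ with $a\neq -b$. Here (SF) is the axiom: whenever $\alpha,\beta,\gamma\in\mathbb{N}[F^\times]$ are such that $\alpha+\gamma\in N_F$ and $\beta-\gamma\in N_F$, and either $\gamma=0$ or $\gamma\notin N_F$, then $\alpha+\beta\in N_F$.
   Context: A commutative hypergroup is a set $G$ with an element $0$ and a map $\boxplus:G\times G\to\mathcal{P}(G)$ (power set) such that for all $a,b,c\in G$: $a\boxplus b\neq\emptyset$; $\bigcup_{d\in b\boxplus c}a\boxplus d=\bigcup_{d\in a\boxplus b}d\boxplus c$; $0\boxplus a=a\boxplus 0=\{a\}$; there is a unique element $-a$ with $0\in a\boxplus(-a)$; $a\boxplus b=b\boxplus a$; and $c\in a\boxplus b$ iff $b\in c\boxplus(-a)$. Multiple hypersums are defined recursively by $\boxplus_{i=1}^n a_i=\bigcup_{b\in\boxplus_{i=1}^{n-1}a_i}b\boxplus a_n$ (the one-term hypersum being $\{a_1\}$ and the empty one $\{0\}$). A (commutative) hyperring is a set $R$ with elements $0,1$, a hyperaddition $\boxplus$ and a multiplication $\cdot$ such that $(R,\boxplus,0)$ is a commutative hypergroup, $(R,\cdot,1)$ is a commutative monoid, $0\cdot a=a\cdot 0=0$, and $a\cdot(b\boxplus c)=ab\boxplus ac$ where $a\cdot(b\boxplus c)=\{ad: d\in b\boxplus c\}$. A hyperfield is a hyperring $H$ with $0\neq 1$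 in which every nonzero element has a multiplicative inverse. For an abelian group $G$, $\mathbb{N}[G]$ is the group semiring (finite formal sums of elements of $G$). The tract $F_H$ associated to a hyperfield $H$ is the multiplicative monoid $H$, with $F_H^\times=H^\times=H\setminus\{0\}$, together with the null set $N_{F_H}\subseteq\mathbb{N}[H^\times]$ consisting of the formal sums $\sum_{i=1}^k x_i$ ($x_i\in H^\times$, $k\geq 0$) with $0\in\boxplus_{i=1}^k x_i$. For $\alpha,\beta\in\mathbb{N}[H^\times]$, $-\alpha$ means $(-1)\cdot\alpha$ and $\alpha-\beta$ means $\alpha+(-1)\cdot\beta$, where $-1\in H^\times$ is the hyperadditive inverse of $1$; thus $x-x$ is not the zero element of $\mathbb{N}[H^\times]$. *)

theory Defs
  imports "HOL-Algebra.Group" "HOL-Library.Multiset"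
begin

definition hyp_inv :: "'a set \<Rightarrow> 'a \<Rightarrow> ('a \<Rightarrow> 'a \<Rightarrow> 'a set) \<Rightarrow> 'a \<Rightarrow> 'a" where
  "hyp_inv G z add a = (THE b. b \<in> G \<and> z \<in> add a b)"

locale comm_hypergroup =
  fixes G :: "'a set" and z :: 'a and add :: "'a \<Rightarrow> 'a \<Rightarrow> 'a set"
  assumes zero_closed: "z \<in> G"
    and add_closed: "\<lbrakk>a \<in> G; b \<in> G\<rbrakk> \<Longrightarrow> add a b \<subseteq> G"
    and add_nonempty: "\<lbrakk>a \<in> G; b \<in> G\<rbrakk> \<Longrightarrow> add a b \<noteq> {}"
    and add_assoc: "\<lbrakk>a \<in> G; b \<in> G; c \<in> G\<rbrakk> \<Longrightarrow> (\<Union>d\<in>add b c. add a d) = (\<Union>d\<in>add a b. add d c)"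
    and add_zero_left: "a \<in> G \<Longrightarrow> add z a = {a}"
    and add_zero_right: "a \<in> G \<Longrightarrow> add a z = {a}"
    and ex1_inv: "a \<in> G \<Longrightarrow> \<exists>!b. b \<in> G \<and> z \<in> add a b"
    and add_commute: "\<lbrakk>a \<in> G; b \<in> G\<rbrakk> \<Longrightarrow> add a b = add b a"
    and reversible: "\<lbrakk>a \<in> G; b \<in> G; c \<in> G\<rbrakk> \<Longrightarrow> c \<in> add a b \<longleftrightarrow> b \<in> add c (hyp_inv G z add a)"

fun hypersum :: "'a \<Rightarrow> ('a \<Rightarrow> 'a \<Rightarrow> 'a set) \<Rightarrow> 'a list \<Rightarrow> 'a set" where
  "hypersum z add [] = {z}"
| "hypersum z add (a # as) = foldl (\<lambda>B c. \<Union>b\<in>B. add b c) {a} as"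

record 'a hyperring = "'a monoid" +
  hzero :: 'a ("\<zero>\<^sub>h\<index>")
  hadd :: "'a \<Rightarrow> 'a \<Rightarrow> 'a set" (infixl "\<boxplus>\<index>" 65)

locale hyperring =
  comm_monoid R + additive: comm_hypergroup "carrier R" "\<zero>\<^sub>h\<^bsub>R\<^esub>" "hadd R"
  for R (structure) +
  assumes zero_mult_left: "a \<in> carrier R \<Longrightarrow> \<zero>\<^sub>h \<otimes> a = \<zero>\<^sub>h"
    and zero_mult_right: "a \<in> carrier R \<Longrightarrow> a \<otimes> \<zero>\<^sub>h = \<zero>\<^sub>h"
    and distrib: "\<lbrakk>a \<in> carrier R; b \<in> carrier R; c \<in> carrier R\<rbrakk>
      \<Longrightarrow> (\<lambda>d. a \<otimes> d) ` (b \<boxplus> c) = (a \<otimes> b) \<boxplus> (a \<otimes> c)"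

locale hyperfield = hyperring +
  assumes zero_not_one: "\<zero>\<^sub>h \<noteq> \<one>"
    and ex_mult_inv: "\<lbrakk>a \<in> carrier R; a \<noteq> \<zero>\<^sub>h\<rbrakk> \<Longrightarrow> \<exists>b\<in>carrier R. a \<otimes> b = \<one>"

definition hneg :: "('a, 'm) hyperring_scheme \<Rightarrow> 'a \<Rightarrow> 'a" where
  "hneg R = hyp_inv (carrier R) \<zero>\<^sub>h\<^bsub>R\<^esub> (hadd R)"

definition stringent :: "('a, 'm) hyperring_scheme \<Rightarrow> bool" where
  "stringent R \<longleftrightarrow>
    (\<forall>a\<in>carrier R. \<forall>b\<in>carrier R. a \<noteq> hneg R b \<longrightarrow> card (a \<boxplus>\<^bsub>R\<^esub> b) = 1)"

text \<open>Elements of the group semiring of the unit group are represented as finite multisets of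
  nonzero elements: addition is multiset union and the zero element is the empty multiset.\<close>

record 'a tract = "'a monoid" +
  tzero :: 'a
  tminus_one :: 'a
  null_set :: "'a multiset set"

definition tract_units :: "('a, 'm) tract_scheme \<Rightarrow> 'a set" where
  "tract_units F = carrier F - {tzero F}"

definition formal_sums :: "('a, 'm) tract_scheme \<Rightarrow> 'a multiset set" where
  "formal_sums F = {\<alpha>. set_mset \<alpha> \<subseteq> tract_units F}"

definition formal_neg :: "('a, 'm) tract_scheme \<Rightarrow> 'a multiset \<Rightarrow> 'a multiset" where
  "formal_neg F \<alpha> = image_mset (\<lambda>x. tminus_one F \<otimes>\<^bsub>F\<^esub> x) \<alpha>"

definition strong_fusion :: "('a, 'm) tract_scheme \<Rightarrow> bool" where
  "strong_fusion F \<longleftrightarrow>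
    (\<forall>\<alpha>\<in>formal_sums F. \<forall>\<beta>\<in>formal_sums F. \<forall>\<gamma>\<in>formal_sums F.
      \<alpha> + \<gamma> \<in> null_set F \<and> \<beta> + formal_neg F \<gamma> \<in> null_set F \<and> (\<gamma> = {#} \<or> \<gamma> \<notin> null_set F)
      \<longrightarrow> \<alpha> + \<beta> \<in> null_set F)"

text \<open>By associativity and commutativity, the hypersum of a list depends only on the underlying
  multiset, so it does not matter which enumeration of a formal sum is chosen below.\<close>

definition hyperfield_tract :: "('a, 'm) hyperring_scheme \<Rightarrow> 'a tract" where
  "hyperfield_tract H =
    \<lparr>carrier = carrier H, monoid.mult = monoid.mult H, one = \<one>\<^bsub>H\<^esub>,
     tzero = \<zero>\<^sub>h\<^bsub>H\<^esub>,
     tminus_one = hneg H \<one>\<^bsub>H\<^esub>,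
     null_set = {mset xs | xs. set xs \<subseteq> carrier H - {\<zero>\<^sub>h\<^bsub>H\<^esub>} \<and>
                               \<zero>\<^sub>h\<^bsub>H\<^esub> \<in> hypersum \<zero>\<^sub>h\<^bsub>H\<^esub> (hadd H) xs}\<rparr>"

end

theory Submission
  imports Defs
begin

text \<open>If \<open>H\<close> satisfies strong fusion and \<open>c, d \<in> a \<boxplus> b\<close> with \<open>a \<noteq> -b\<close>, then fusing
  \<open>-c + (a + b)\<close> with \<open>d - (a + b)\<close> along \<open>a + b\<close> shows that \<open>d - c\<close> is null, so \<open>c = d\<close>.
  Conversely, in a stringent hyperfield the hypersum of a non-null formal sum \<open>\<gamma>\<close> is a single
  element \<open>g\<close>; so \<open>-g\<close> is a hypersum of \<open>\<alpha>\<close> and \<open>g\<close> is one of \<open>\<beta>\<close>, whence \<open>\<alpha> + \<beta>\<close> is null.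
  To see that the hypersum is single, combine two terms \<open>x \<noteq> -y\<close> into one and induct on the
  length. If no such pair exists, then \<open>\<gamma>\<close> has at most two terms or all its terms are equal to
  some \<open>x = -x\<close>. In the latter case either \<open>x \<boxplus> x \<boxplus> x = {x}\<close>, which shortens the sum, or
  \<open>x \<in> x \<boxplus> x\<close>, which makes it null.\<close>

section \<open>Negation in a commutative hypergroup\<close>

context comm_hypergroup
begin

abbreviation neg :: "'a \<Rightarrow> 'a" where
  "neg \<equiv> hyp_inv G z add"

lemma neg_props:
  assumes "a \<in> G"
  shows neg_closed: "neg a \<in> G" and zero_in_add_neg: "z \<in> add a (neg a)"
  using theI'[OF ex1_inv[OF assms]] by (auto simp: hyp_inv_def)

lemma zero_in_add_iff:
  assumes "a \<in> G" "b \<in> G"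
  shows "z \<in> add a b \<longleftrightarrow> b = neg a"
  using ex1_inv[OF assms(1)] neg_props[OF assms(1)] assms(2) by auto

lemma neg_neg: "a \<in> G \<Longrightarrow> neg (neg a) = a"
  by (metis neg_closed zero_in_add_neg add_commute zero_in_add_iff)

lemma neg_zero: "neg z = z"
  using zero_in_add_iff[of z z] add_zero_left zero_closed by auto

lemma add_memD: "\<lbrakk>c \<in> add a b; a \<in> G; b \<in> G\<rbrakk> \<Longrightarrow> c \<in> G"
  using add_closed by blast

lemma neg_in_add_neg:
  assumes "a \<in> G" "b \<in> G" "c \<in> add a b"
  shows "neg c \<in> add (neg a) (neg b)"
proof -
  have c: "c \<in> G"
    using assms add_memD by blast
  have "b \<in> add c (neg a)"
    using assms c reversible by blast
  hence "neg a \<in> add b (neg c)"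
    using assms c reversible neg_closed by blast
  thus ?thesis
    using assms c reversible neg_closed by blast
qed

lemma add_assoc_mem:
  assumes "a \<in> G" "b \<in> G" "c \<in> G"
  shows "(\<exists>d\<in>add b c. u \<in> add a d) \<longleftrightarrow> (\<exists>d\<in>add a b. u \<in> add d c)"
  using add_assoc[OF assms] by blast

section \<open>Hypersums of lists: concatenation and independence of the order\<close>

primrec hsum :: "'a list \<Rightarrow> 'a set" where
  "hsum [] = {z}"
| "hsum (x # xs) = (\<Union>b\<in>hsum xs. add x b)"

lemma hsum_closed: "set xs \<subseteq> G \<Longrightarrow> hsum xs \<subseteq> G"
proof (induction xs)
  case (Cons x xs)
  thus ?case
    using add_memD by (simp add: UN_subset_iff subset_iff) blast
qed (simp add: zero_closed)

lemma hsum_singleton: "x \<in> G \<Longrightarrow> hsum [x] = {x}"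
  by (simp add: add_zero_right)

text \<open>Set-valued associativity, used elementwise as \<open>add_assoc_mem\<close>, moves the
  head \<open>x\<close> into the first summand.\<close>

lemma hsum_append:
  assumes "set xs \<subseteq> G" "set ys \<subseteq> G"
  shows "hsum (xs @ ys) = (\<Union>b\<in>hsum xs. \<Union>c\<in>hsum ys. add b c)"
  using assms(1)
proof (induction xs)
  case Nil
  thus ?case
    using hsum_closed[OF assms(2)] by (auto simp: add_zero_left subset_iff)
next
  case (Cons x xs)
  have cl: "x \<in> G" "hsum xs \<subseteq> G" "hsum ys \<subseteq> G"
    using Cons.prems hsum_closed assms by auto
  have "u \<in> hsum ((x # xs) @ ys) \<longleftrightarrow> (\<exists>b\<in>hsum xs. \<exists>c\<in>hsum ys. \<exists>d\<in>add b c. u \<in> add x d)" for u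
    using Cons.IH Cons.prems by simp
  moreover have "(\<exists>d\<in>add b c. u \<in> add x d) \<longleftrightarrow> (\<exists>d\<in>add x b. u \<in> add d c)"
    if "b \<in> hsum xs" "c \<in> hsum ys" for u b c
    using that cl by (intro add_assoc_mem) auto
  ultimately have "u \<in> hsum ((x # xs) @ ys) \<longleftrightarrow>
      (\<exists>b\<in>hsum xs. \<exists>c\<in>hsum ys. \<exists>d\<in>add x b. u \<in> add d c)" for u
    by simp
  thus ?case
    unfolding hsum.simps by blast
qed

text \<open>\<open>hsum\<close> nests to the right and ends in \<open>z\<close>, which suits list
  induction, while \<open>hypersum\<close> folds from the left. The fold is tracked by letting its
  accumulator be the \<open>hsum\<close> of the prefix \<open>ys\<close> already read.\<close>

lemma hypersum_eq_hsum:
  assumes "set xs \<subseteq> G"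
  shows "hypersum z add xs = hsum xs"
proof -
  have fold: "foldl (\<lambda>B c. \<Union>b\<in>B. add b c) (hsum ys) xs = hsum (ys @ xs)" if "set ys \<subseteq> G" for ys
    using assms that
  proof (induction xs arbitrary: ys)
    case (Cons x xs)
    have "hsum (ys @ [x]) = (\<Union>b\<in>hsum ys. add b x)"
      using hsum_append[of ys "[x]"] Cons.prems hsum_singleton by simp
    thus ?case
      using Cons.IH[of "ys @ [x]"] Cons.prems by simp
  qed simp
  show ?thesis
  proof (cases xs)
    case (Cons x xs')
    have "hypersum z add xs = foldl (\<lambda>B c. \<Union>b\<in>B. add b c) (hsum []) xs"
      using Cons assms by (simp add: add_zero_left)
    thus ?thesis
      using fold[of "[]"] by simp
  qed simp
qed

lemma hsum_append_commute:
  assumes "set xs \<subseteq> G" "set ys \<subseteq> G"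
  shows "hsum (xs @ ys) = hsum (ys @ xs)"
  using hsum_append assms hsum_closed add_commute by (auto; metis subsetD)

text \<open>Rotations suffice: moving \<open>us\<close> behind the rest brings \<open>x\<close> to
  the front of \<open>ys\<close>, and the tails fall to the induction hypothesis.\<close>

lemma hsum_mset_cong:
  assumes "mset xs = mset ys" "set xs \<subseteq> G"
  shows "hsum xs = hsum ys"
  using assms
proof (induction xs arbitrary: ys)
  case (Cons x xs)
  obtain us vs where ys: "ys = us @ x # vs"
    using Cons.prems(1) by (metis list.set_intros(1) set_mset_mset split_list)
  have xs: "mset xs = mset (vs @ us)"
    using Cons.prems(1) ys by simp
  have "set ys \<subseteq> G"
    using Cons.prems by (metis set_mset_mset)
  hence "hsum ys = hsum (x # vs @ us)"
    using hsum_append_commute[of us "x # vs"] ys by simp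
  thus ?case
    using Cons.IH[OF xs] Cons.prems(2) by simp
qed simp

text \<open>By uniqueness of inverses a zero sum can be cut in two. This is how a formal sum is
  traded for a single element of its hypersum.\<close>

lemma zero_in_hsum_append_iff:
  assumes "set xs \<subseteq> G" "set ys \<subseteq> G"
  shows "z \<in> hsum (xs @ ys) \<longleftrightarrow> (\<exists>b\<in>hsum xs. neg b \<in> hsum ys)"
  using hsum_append[OF assms] hsum_closed assms zero_in_add_iff by (auto; metis subsetD)

lemma neg_in_hsum_neg:
  assumes "set xs \<subseteq> G" "u \<in> hsum xs"
  shows "neg u \<in> hsum (map neg xs)"
  using assms
proof (induction xs arbitrary: u)
  case Nil
  thus ?case
    by (simp add: neg_zero)
next
  case (Cons x xs)
  then obtain b where b: "b \<in> hsum xs" "u \<in> add x b"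
    by auto
  moreover have "b \<in> G"
    using b Cons.prems hsum_closed by auto
  ultimately show ?case
    using Cons.IH[of b] Cons.prems(1) neg_in_add_neg[of x b u] by auto
qed

lemma hsum_replace:
  assumes "set xs \<subseteq> G" "set ys \<subseteq> G" "set zs \<subseteq> G" "hsum xs = hsum ys"
  shows "hsum (xs @ zs) = hsum (ys @ zs)"
  using assms by (simp add: hsum_append)

section \<open>Single-valued hypersums under stringency\<close>

lemma zero_in_hsum_replicate:
  assumes "x \<in> G" "neg x = x" "x \<in> add x x"
  shows "z \<in> hsum (replicate (Suc (Suc n)) x)"
proof -
  \<comment> \<open>As \<open>x\<close> lies in \<open>add x x\<close>, it survives adding further
    copies; one last copy cancels it because \<open>neg x = x\<close>.\<close>
  have "x \<in> hsum (replicate (Suc n) x)"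
    by (induction n) (use assms in \<open>auto simp: add_zero_right\<close>)
  thus ?thesis
    using assms zero_in_add_neg[of x] by (metis UN_iff hsum.simps(2) replicate_Suc)
qed

text \<open>Only addition matters here. A step drops one or two terms, hence the strong induction on
  length.\<close>

lemma hsum_single_valued:
  assumes stringent: "\<And>a b. \<lbrakk>a \<in> G; b \<in> G; a \<noteq> neg b\<rbrakk> \<Longrightarrow> card (add a b) = 1"
    and "set xs \<subseteq> G" "z \<notin> hsum xs"
  shows "\<exists>g. hsum xs = {g}"
  using assms(2,3)
proof (induction xs rule: length_induct)
  case (1 xs)
  \<comment> \<open>The reduction used twice below: terms \<open>us\<close>, in any positions, give
    way to fewer terms \<open>vs\<close> with the same hypersum.\<close>
  have shorten: ?case
    if "mset xs = mset (us @ ws)" "hsum us = hsum vs" "length vs < length us" "set vs \<subseteq> G"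
    for us vs ws
  proof -
    have sub: "set us \<subseteq> G" "set ws \<subseteq> G"
      using that(1) "1.prems"(1) by (metis Un_subset_iff set_append set_mset_mset)+
    have "hsum xs = hsum (vs @ ws)"
      using hsum_mset_cong[OF that(1)] hsum_replace[OF sub(1) that(4) sub(2) that(2)] "1.prems" by simp
    moreover have "length (vs @ ws) < length xs"
      using that(1,3) by (metis add_less_cancel_right length_append size_mset)
    ultimately show ?thesis
      using "1.IH" "1.prems" sub that(4) by (metis Un_subset_iff set_append)
  qed
  show ?case
  proof (cases "\<exists>x y zs. mset xs = mset (x # y # zs) \<and> x \<noteq> neg y")
    case True
    then obtain x y zs where xyzs: "mset xs = mset (x # y # zs)" "x \<noteq> neg y"
      by blast
    hence xy: "x \<in> G" "y \<in> G"
      using "1.prems"(1) by (metis list.set_intros set_mset_mset subsetD)+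
    then obtain s where s: "add x y = {s}"
      using stringent xyzs(2) by (meson card_1_singletonE)
    moreover have "s \<in> G"
      using s xy add_closed by blast
    ultimately have "hsum [x, y] = hsum [s]" "set [s] \<subseteq> G"
      using xy by (auto simp: add_zero_right)
    thus ?thesis
      using shorten[of "[x, y]" zs "[s]"] xyzs(1) by simp
  next
    case False
    hence cancel: "x = neg y" if "mset xs = mset (x # y # zs)" for x y zs
      using that by blast
    consider "xs = []" | x where "xs = [x]" | x y where "xs = [x, y]"
      | x y w ws where "xs = x # y # w # ws"
      by (metis list.exhaust)
    thus ?thesis
    proof cases
      case 1
      thus ?thesis
        by simp
    next
      case 2
      thus ?thesis
        using "1.prems" hsum_singleton by auto
    next
      case 3
      hence "x = neg y" "y \<in> G"
        using cancel[of x y "[]"] "1.prems" by auto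
      thus ?thesis
        using zero_in_add_iff[of x y] neg_neg neg_closed "1.prems"(2) 3 by (simp add: add_zero_right)
    next
      case 4
      have G: "x \<in> G" "y \<in> G" "w \<in> G"
        using "1.prems" 4 by auto
      \<comment> \<open>Among three pairwise opposite terms, \<open>x\<close> and \<open>y\<close>
        both equal \<open>neg w\<close>; thus \<open>x = y\<close> and
        \<open>x = neg x\<close>.\<close>
      have y: "y = neg w" and w: "w = neg x" "x = neg w"
        using cancel[of y w "x # ws"] cancel[of w x "y # ws"] cancel[of x w "y # ws"] 4 by auto
      have x: "neg x = x"
        using cancel[of x y "w # ws"] 4 y w by (metis (full_types))
      have "v = x" if v: "v \<in> set ws" for v
      proof -
        have "mset xs = mset (v # x # y # w # remove1 v ws)"
          using 4 v by simp
        thus ?thesis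
          using cancel x by metis
      qed
      hence eq: "xs = replicate (Suc (Suc (Suc (length ws)))) x"
        using 4 x y w by (metis length_Cons replicate_Suc replicate_eqI)
      have "x \<notin> add x x"
        using zero_in_hsum_replicate[of x "Suc (length ws)"] "1.prems"(2) eq G x by auto
      have "add x t = {x}" if "t \<in> add x x" for t
      proof -
        \<comment> \<open>Reversibility with \<open>neg x = x\<close> puts \<open>x\<close> into
          \<open>add x t\<close>; since \<open>t\<close> differs from \<open>x = neg x\<close>,
          stringency leaves nothing else there.\<close>
        have t: "t \<in> G" "t \<noteq> x"
          using that add_memD G \<open>x \<notin> add x x\<close> by auto
        have "x \<in> add x t"
          using reversible[of x x t] that t G x add_commute by metis
        moreover have "x \<noteq> neg t"
          using t G x neg_neg by metis
        ultimately show ?thesis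
          using stringent[of x t] G t by (metis card_1_singletonE singletonD)
      qed
      \<comment> \<open>A witness that \<open>add x x\<close> is nonempty, so that the union of the
        sets \<open>add x t\<close> is \<open>{x}\<close>.\<close>
      moreover have "z \<in> add x x"
        using zero_in_add_neg[of x] x G by simp
      ultimately have "hsum [x, x, x] = hsum [x]"
        using G by (auto simp: add_zero_right)
      thus ?thesis
        using shorten[of "[x, x, x]" "replicate (length ws) x" "[x]"] eq G by simp
    qed
  qed
qed

end

section \<open>From the tract to hypersums of lists\<close>

context hyperfield
begin

text \<open>Distribute \<open>x\<close> over a hypersum of 1 and -1 containing 0, then use
  uniqueness of the inverse.\<close>

lemma minus_one_mult:
  assumes "x \<in> carrier R"
  shows "hneg R \<one> \<otimes> x = hneg R x"
proof -
  have m: "hneg R \<one> \<in> carrier R" "\<zero>\<^sub>h \<in> \<one> \<boxplus> hneg R \<one>"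
    using additive.neg_props[of \<one>] by (auto simp: hneg_def)
  have "x \<otimes> \<zero>\<^sub>h \<in> (x \<otimes> \<one>) \<boxplus> (x \<otimes> hneg R \<one>)"
    using distrib[of x \<one> "hneg R \<one>"] assms m by blast
  hence "\<zero>\<^sub>h \<in> x \<boxplus> (hneg R \<one> \<otimes> x)"
    using assms m zero_mult_right m_comm by simp
  thus ?thesis
    using additive.zero_in_add_iff[of x "hneg R \<one> \<otimes> x"] assms m by (simp add: hneg_def)
qed

lemma hneg_nonzero:
  assumes "x \<in> carrier R - {\<zero>\<^sub>h}"
  shows "hneg R x \<in> carrier R - {\<zero>\<^sub>h}"
  using assms additive.neg_closed[of x] additive.neg_neg[of x] additive.neg_zero
  by (auto simp: hneg_def)

text \<open>The null set asks for some enumeration; order independence makes the given one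
  \<open>xs\<close> serve.\<close>

lemma mset_null_iff:
  "mset xs \<in> null_set (hyperfield_tract R) \<longleftrightarrow>
     set xs \<subseteq> carrier R - {\<zero>\<^sub>h} \<and> \<zero>\<^sub>h \<in> additive.hsum xs"
proof -
  have hsum: "hypersum \<zero>\<^sub>h (hadd R) ys = additive.hsum ys"
    if "set ys \<subseteq> carrier R - {\<zero>\<^sub>h}" for ys
    using that additive.hypersum_eq_hsum by (meson Diff_subset subset_trans)
  have null: "mset xs \<in> null_set (hyperfield_tract R) \<longleftrightarrow>
      (\<exists>ys. mset xs = mset ys \<and> set ys \<subseteq> carrier R - {\<zero>\<^sub>h} \<and>
        \<zero>\<^sub>h \<in> hypersum \<zero>\<^sub>h (hadd R) ys)"
    by (simp add: hyperfield_tract_def)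
  show ?thesis
  proof
    assume "mset xs \<in> null_set (hyperfield_tract R)"
    then obtain ys where ys: "mset xs = mset ys" "set ys \<subseteq> carrier R - {\<zero>\<^sub>h}"
      "\<zero>\<^sub>h \<in> hypersum \<zero>\<^sub>h (hadd R) ys"
      using null by blast
    hence "set xs = set ys"
      using mset_eq_setD by blast
    moreover from this have "additive.hsum xs = additive.hsum ys"
      using ys by (intro additive.hsum_mset_cong) auto
    ultimately show "set xs \<subseteq> carrier R - {\<zero>\<^sub>h} \<and> \<zero>\<^sub>h \<in> additive.hsum xs"
      using ys hsum[of ys] by simp
  next
    assume "set xs \<subseteq> carrier R - {\<zero>\<^sub>h} \<and> \<zero>\<^sub>h \<in> additive.hsum xs"
    thus "mset xs \<in> null_set (hyperfield_tract R)"
      using null hsum[of xs] by blast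
  qed
qed

lemma mset_formal_sums_iff:
  "mset xs \<in> formal_sums (hyperfield_tract R) \<longleftrightarrow> set xs \<subseteq> carrier R - {\<zero>\<^sub>h}"
  by (simp add: formal_sums_def tract_units_def hyperfield_tract_def)

lemma formal_neg_mset:
  assumes "set xs \<subseteq> carrier R"
  shows "formal_neg (hyperfield_tract R) (mset xs) = mset (map (hneg R) xs)"
proof -
  have "image_mset (\<lambda>x. hneg R \<one> \<otimes> x) (mset xs) = image_mset (hneg R) (mset xs)"
    using assms minus_one_mult by (intro image_mset_cong) auto
  thus ?thesis
    by (simp add: formal_neg_def hyperfield_tract_def)
qed

text \<open>The non-null branch of the axiom, in list form; it is applied with
  \<open>cs = [a, b]\<close>.\<close>

lemma strong_fusion_hsumD:
  assumes "strong_fusion (hyperfield_tract R)"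
    and nz: "set as \<subseteq> carrier R - {\<zero>\<^sub>h}" "set bs \<subseteq> carrier R - {\<zero>\<^sub>h}"
      "set cs \<subseteq> carrier R - {\<zero>\<^sub>h}"
    and "\<zero>\<^sub>h \<in> additive.hsum (as @ cs)" "\<zero>\<^sub>h \<in> additive.hsum (bs @ map (hneg R) cs)"
    and "\<zero>\<^sub>h \<notin> additive.hsum cs"
  shows "\<zero>\<^sub>h \<in> additive.hsum (as @ bs)"
proof -
  have negs: "set (map (hneg R) cs) \<subseteq> carrier R - {\<zero>\<^sub>h}"
    using nz(3) hneg_nonzero by auto
  have "mset as \<in> formal_sums (hyperfield_tract R)" "mset bs \<in> formal_sums (hyperfield_tract R)"
    "mset cs \<in> formal_sums (hyperfield_tract R)"
    using nz by (simp_all only: mset_formal_sums_iff)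
  moreover have "mset as + mset cs \<in> null_set (hyperfield_tract R)"
    using mset_null_iff[of "as @ cs"] nz assms(5) by simp
  moreover have "formal_neg (hyperfield_tract R) (mset cs) = mset (map (hneg R) cs)"
    using nz(3) by (intro formal_neg_mset) auto
  moreover have "mset bs + mset (map (hneg R) cs) \<in> null_set (hyperfield_tract R)"
    using mset_null_iff[of "bs @ map (hneg R) cs"] nz negs assms(6) by simp
  moreover have "mset cs \<notin> null_set (hyperfield_tract R)"
    using mset_null_iff[of cs] assms(7) by simp
  ultimately have "mset as + mset bs \<in> null_set (hyperfield_tract R)"
    using assms(1)[unfolded strong_fusion_def, rule_format, of "mset as" "mset bs" "mset cs"]
    by (simp only: simp_thms)
  thus ?thesis
    using mset_null_iff[of "as @ bs"] by simp
qed

section \<open>From strong fusion to stringency\<close>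

lemma strong_fusion_imp_stringent:
  assumes "strong_fusion (hyperfield_tract R)"
  shows "stringent R"
  unfolding stringent_def
proof (intro ballI impI)
  fix a b
  assume ab: "a \<in> carrier R" "b \<in> carrier R" "a \<noteq> hneg R b"
  show "card (a \<boxplus> b) = 1"
  \<comment> \<open>Formal sums admit only nonzero terms, so a zero summand is treated by the unit
    laws.\<close>
  proof (cases "a = \<zero>\<^sub>h \<or> b = \<zero>\<^sub>h")
    case True
    thus ?thesis
      using ab additive.add_zero_left additive.add_zero_right by auto
  next
    case False
    \<comment> \<open>This makes the fused sum \<open>[a, b]\<close> non-null and also forces
      \<open>c\<close> and \<open>d\<close> to be nonzero.\<close>
    have zero: "\<zero>\<^sub>h \<notin> a \<boxplus> b"
      using ab additive.zero_in_add_iff[of a b] additive.neg_neg[of a] by (auto simp: hneg_def)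
    have "c = d" if cd: "c \<in> a \<boxplus> b" "d \<in> a \<boxplus> b" for c d
    proof -
      have nz: "a \<in> carrier R - {\<zero>\<^sub>h}" "b \<in> carrier R - {\<zero>\<^sub>h}"
        "c \<in> carrier R - {\<zero>\<^sub>h}" "d \<in> carrier R - {\<zero>\<^sub>h}"
        using ab cd zero False additive.add_closed[of a b] by auto
      have nn: "hneg R a \<in> carrier R - {\<zero>\<^sub>h}" "hneg R b \<in> carrier R - {\<zero>\<^sub>h}"
        "hneg R c \<in> carrier R - {\<zero>\<^sub>h}"
        using nz hneg_nonzero by blast+
      have c: "\<zero>\<^sub>h \<in> additive.hsum ([hneg R c] @ [a, b])"
        using additive.zero_in_hsum_append_iff[of "[hneg R c]" "[a, b]"] nz nn cd
        by (simp add: additive.add_zero_right additive.neg_neg hneg_def)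
      have d: "\<zero>\<^sub>h \<in> additive.hsum ([d] @ map (hneg R) [a, b])"
        using additive.zero_in_hsum_append_iff[of "[d]" "map (hneg R) [a, b]"] nz nn cd
          additive.neg_in_add_neg[of a b d]
        by (simp add: additive.add_zero_right hneg_def)
      have "\<zero>\<^sub>h \<in> additive.hsum ([hneg R c] @ [d])"
        using strong_fusion_hsumD[of "[hneg R c]" "[d]" "[a, b]", OF assms _ _ _ c d] nz nn zero
        by (simp add: additive.add_zero_right)
      thus "c = d"
        using additive.zero_in_hsum_append_iff[of "[hneg R c]" "[d]"] nz nn
        by (simp add: additive.add_zero_right additive.neg_neg hneg_def)
    qed
    moreover have "a \<boxplus> b \<noteq> {}"
      using ab additive.add_nonempty by blast
    ultimately have "is_singleton (a \<boxplus> b)"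
      by (metis is_singletonI')
    thus ?thesis
      by (simp add: is_singleton_altdef)
  qed
qed

section \<open>From stringency to strong fusion\<close>

lemma stringent_imp_strong_fusion:
  assumes "stringent R"
  shows "strong_fusion (hyperfield_tract R)"
  unfolding strong_fusion_def
proof (intro ballI impI)
  let ?F = "hyperfield_tract R"
  fix \<alpha> \<beta> \<gamma>
  assume sums: "\<alpha> \<in> formal_sums ?F" "\<beta> \<in> formal_sums ?F" "\<gamma> \<in> formal_sums ?F"
    and hyp: "\<alpha> + \<gamma> \<in> null_set ?F \<and> \<beta> + formal_neg ?F \<gamma> \<in> null_set ?F \<and> (\<gamma> = {#} \<or> \<gamma> \<notin> null_set ?F)"
  obtain as bs cs where lists: "\<alpha> = mset as" "\<beta> = mset bs" "\<gamma> = mset cs"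
    by (metis ex_mset)
  have nz: "set as \<subseteq> carrier R - {\<zero>\<^sub>h}" "set bs \<subseteq> carrier R - {\<zero>\<^sub>h}" "set cs \<subseteq> carrier R - {\<zero>\<^sub>h}"
    using sums lists mset_formal_sums_iff by auto
  hence G: "set as \<subseteq> carrier R" "set bs \<subseteq> carrier R" "set cs \<subseteq> carrier R"
    by auto
  have negG: "set (map (hneg R) cs) \<subseteq> carrier R"
    using G additive.neg_closed by (auto simp: hneg_def)
  have "mset (as @ cs) \<in> null_set ?F" "mset (bs @ map (hneg R) cs) \<in> null_set ?F"
    using hyp lists formal_neg_mset[OF G(3)] by auto
  hence "\<zero>\<^sub>h \<in> additive.hsum (as @ cs)" "\<zero>\<^sub>h \<in> additive.hsum (bs @ map (hneg R) cs)"
    unfolding mset_null_iff by auto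
  \<comment> \<open>Both null sums are cut at \<gamma>. After negating the second cut,
    \<open>hneg R s\<close> and \<open>t\<close> lie in the same set
    \<open>additive.hsum cs\<close>.\<close>
  then obtain s t where s: "s \<in> additive.hsum as" "hneg R s \<in> additive.hsum cs"
    and t: "t \<in> additive.hsum bs" "hneg R t \<in> additive.hsum (map (hneg R) cs)"
    using additive.zero_in_hsum_append_iff G negG unfolding hneg_def by meson
  have tG: "t \<in> carrier R"
    using t additive.hsum_closed G by blast
  have "map (hneg R) (map (hneg R) cs) = cs"
    using G additive.neg_neg by (auto simp: hneg_def intro!: map_idI)
  hence t': "t \<in> additive.hsum cs"
    using additive.neg_in_hsum_neg[OF negG t(2)] additive.neg_neg[OF tG] by (simp add: hneg_def)
  \<comment> \<open>The empty \<gamma> is null, so the general lemma does not cover it; its hypersum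
    is the singleton of 0 by definition.\<close>
  have "\<exists>g. additive.hsum cs = {g}"
  proof (cases "\<gamma> = {#}")
    case True
    thus ?thesis
      using lists by simp
  next
    case False
    hence "\<zero>\<^sub>h \<notin> additive.hsum cs"
      using hyp lists nz mset_null_iff by auto
    thus ?thesis
      using additive.hsum_single_valued[OF _ G(3)] assms by (simp add: stringent_def hneg_def)
  qed
  hence "hneg R s = t"
    using s t' by auto
  hence "\<zero>\<^sub>h \<in> additive.hsum (as @ bs)"
    using additive.zero_in_hsum_append_iff[of as bs] G s t by (auto simp: hneg_def)
  thus "\<alpha> + \<beta> \<in> null_set ?F"
    using mset_null_iff[of "as @ bs"] nz lists by simp
qed

end

theorem proposition1p13:
  fixes H :: "('a, 'm) hyperring_scheme"
  assumes "hyperfield H"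
  shows "strong_fusion (hyperfield_tract H) \<longleftrightarrow> stringent H"
  using hyperfield.strong_fusion_imp_stringent[OF assms]
    hyperfield.stringent_imp_strong_fusion[OF assms]
  by blast

end
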